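(* Let $Q$ be a prime power with $Q\not\equiv 1\pmod{3}$, and let $\alpha$ be any fixed element of $\mathbb{F}_{Q^2}$ for which $\alpha^{Q-1}$ has order $6$ if $Q\equiv 5\pmod{6}$, order $3$ if $Q\equiv 0\pmod{2}$, and order $2$ if $Q\equiv 0\pmod{3}$. Then the set of all polynomials $\beta x^{Q+2}+\alpha\gamma x$ with $\beta,\gamma\in\mathbb{F}_Q$, where at least one of $\beta,\gamma$ is nonzero, corresponds to a complete set of $Q^2-1$ mutually orthogonal latin squares of order $Q^2$.
   Context: For a prime power $q$, $\mathbb{F}_q$ denotes the finite field with $q$ elements, and $\mathbb{F}_Q$ is regarded as a subfield of $\mathbb{F}_{Q^2}$; orders of elements are taken in the multiplicative group $\mathbb{F}_{Q^2}^*$. A latin square of order $n$ is an $n\times n$ matrix with entries from an $n$-element set $S$ such that each element of $S$ occurs exactly once in each row and each column. Two latin squares $[\alpha_{ij}]$ and $[\beta_{ij}]$ with the same set $S$ are orthogonal if every ordered pair in $S\times S$ occurs as $(\alpha_{ij},\beta_{ij})$ for some $i,j$. A set of mutually orthogonal latin squares (MOLS) is a set of pairwise orthogonal latin squares; a complete set of MOLS of order $n$ is a set of $n-1$ MOLS of order $n$. Here $S=\mathbb{F}_q$ with $q=Q^2$, rows and columns are labeled by the elements of $\mathbb{F}_q$, and a polynomial $f$ inducing a permutation of $\mathbb{F}_q$ corresponds to the latin square whose $ij$-th entry is $i+f(j)$, for $i,j\in\mathbb{F}_q$. *)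

theory Defs
  imports
    "HOL-Analysis.Finite_Cartesian_Product"
    "HOL-Computational_Algebra.Polynomial"
    "HOL-Number_Theory.Cong"
    "HOL-Number_Theory.Prime_Powers"
begin

definition is_subfield :: "'a::field set \<Rightarrow> bool" where
  "is_subfield K \<longleftrightarrow> 0 \<in> K \<and> 1 \<in> K \<and>
     (\<forall>x\<in>K. \<forall>y\<in>K. x + y \<in> K \<and> x * y \<in> K) \<and>
     (\<forall>x\<in>K. - x \<in> K \<and> inverse x \<in> K)"

(* A predicate rather than a function, so that 0, which is not in the multiplicative
   group, has no order at all. *)
definition has_mult_order :: "'a::field \<Rightarrow> nat \<Rightarrow> bool" where
  "has_mult_order x n \<longleftrightarrow> 0 < n \<and> x ^ n = 1 \<and> (\<forall>m. 0 < m \<and> m < n \<longrightarrow> x ^ m \<noteq> 1)"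

(* The order of a square is CARD('n); rows and columns are labelled by the index type 'n. *)
definition latin_square :: "'s set \<Rightarrow> 's ^ 'n ^ 'n \<Rightarrow> bool" where
  "latin_square S L \<longleftrightarrow> card S = CARD('n) \<and>
     (\<forall>i j. L $ i $ j \<in> S) \<and>
     (\<forall>i. \<forall>s\<in>S. \<exists>!j. L $ i $ j = s) \<and>
     (\<forall>j. \<forall>s\<in>S. \<exists>!i. L $ i $ j = s)"

definition orthogonal_squares :: "'s set \<Rightarrow> 's ^ 'n ^ 'n \<Rightarrow> 's ^ 'n ^ 'n \<Rightarrow> bool" where
  "orthogonal_squares S A B \<longleftrightarrow>
     (\<forall>s\<in>S. \<forall>t\<in>S. \<exists>i j. A $ i $ j = s \<and> B $ i $ j = t)"

definition is_MOLS :: "'s set \<Rightarrow> ('s ^ 'n ^ 'n) set \<Rightarrow> bool" where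
  "is_MOLS S M \<longleftrightarrow> (\<forall>L\<in>M. latin_square S L) \<and> pairwise (orthogonal_squares S) M"

definition complete_MOLS :: "'s set \<Rightarrow> ('s ^ 'n ^ 'n) set \<Rightarrow> bool" where
  "complete_MOLS S M \<longleftrightarrow> is_MOLS S M \<and> finite M \<and> card M = CARD('n) - 1"

definition poly_square :: "'a::finite_field poly \<Rightarrow> (('a, 'a) vec, 'a) vec" where
  "poly_square f = (\<chi> i j. i + poly f j)"

end

theory Submission
  imports Defs
begin

text \<open>
  Write \<open>\<omega> = \<alpha> ^ (Q - 1)\<close>. In each of the three cases \<open>\<omega>\<^sup>2 - \<omega> + 1 = 0\<close> and \<open>\<omega> \<noteq> 1\<close>. Since the
  polynomials in question together with \<open>0\<close> form an additive group, everything reduces to showing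
  that each of them is injective. Taking norms to \<open>\<bbbF>\<^sub>Q\<close> in \<open>x (\<beta> x\<^bsup>Q+1\<^esup> + \<alpha> \<gamma>) = y (\<beta> y\<^bsup>Q+1\<^esup> + \<alpha> \<gamma>)\<close>
  yields a cubic equation between the norms \<open>m\<close> and \<open>k\<close> of \<open>x\<close> and \<open>y\<close>. Up to a unit, the difference
  of its two sides is \<open>m - k\<close> times the two factors \<open>\<beta> (m + \<omega> k) + \<gamma> \<omega> \<alpha>\<close> and
  \<open>\<beta> (k + \<omega> m) + \<gamma> \<omega> \<alpha>\<close>, which are conjugate up to a unit; so if one of them vanishes then so
  does the other, and subtracting them gives \<open>m = k\<close>.
\<close>

text \<open>Here \<open>\<sigma>\<close> abstracts the map x -> x^Q, an involution of the field of
  order Q^2, so that \<open>x\<^sup>2 * \<sigma> x\<close> stands for x^(Q+2).\<close>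

lemma involution_cubic_inj:
  fixes \<sigma> :: "'a::field \<Rightarrow> 'a" and \<alpha> \<omega> \<beta> \<gamma> :: 'a
  assumes add: "\<And>x y. \<sigma> (x + y) = \<sigma> x + \<sigma> y"
    and mult: "\<And>x y. \<sigma> (x * y) = \<sigma> x * \<sigma> y"
    and invol: "\<And>x. \<sigma> (\<sigma> x) = x"
    and \<alpha>: "\<alpha> \<noteq> 0" "\<sigma> \<alpha> = \<omega> * \<alpha>"
    and \<omega>: "\<omega> \<noteq> 1" "\<omega>\<^sup>2 - \<omega> + 1 = 0"
    and fixed: "\<sigma> \<beta> = \<beta>" "\<sigma> \<gamma> = \<gamma>"
    and nz: "\<beta> \<noteq> 0 \<or> \<gamma> \<noteq> 0"
  shows "inj (\<lambda>x. \<beta> * (x\<^sup>2 * \<sigma> x) + \<alpha> * \<gamma> * x)"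
proof (rule injI)
  fix x y
  assume eq: "\<beta> * (x\<^sup>2 * \<sigma> x) + \<alpha> * \<gamma> * x = \<beta> * (y\<^sup>2 * \<sigma> y) + \<alpha> * \<gamma> * y"
  define m where "m = x * \<sigma> x"
  define k where "k = y * \<sigma> y"
  have \<sigma>m: "\<sigma> m = m" and \<sigma>k: "\<sigma> k = k"
    by (simp_all add: m_def k_def mult invol mult.commute)
  have \<sigma>0: "\<sigma> 0 = 0"
    using add[of 0 0] by (metis add.right_neutral add_left_cancel)
  \<comment> \<open>Applying \<open>\<sigma>\<close> twice to \<open>\<alpha>\<close> multiplies it
    by \<open>\<sigma> \<omega> * \<omega>\<close>.\<close>
  have \<sigma>\<omega>: "\<sigma> \<omega> * \<omega> = 1"
    using invol[of \<alpha>] \<alpha> by (simp add: mult)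
  have eq1: "x * (\<beta> * m + \<alpha> * \<gamma>) = y * (\<beta> * k + \<alpha> * \<gamma>)"
    using eq by (simp add: m_def k_def algebra_simps power2_eq_square)
  have eq2: "\<sigma> x * (\<beta> * m + \<omega> * \<alpha> * \<gamma>) = \<sigma> y * (\<beta> * k + \<omega> * \<alpha> * \<gamma>)"
    using arg_cong[OF eq1, of \<sigma>] by (simp add: mult add \<sigma>m \<sigma>k fixed \<alpha>)
  have norms: "m * (\<beta> * m + \<alpha> * \<gamma>) * (\<beta> * m + \<omega> * \<alpha> * \<gamma>)
      = k * (\<beta> * k + \<alpha> * \<gamma>) * (\<beta> * k + \<omega> * \<alpha> * \<gamma>)"
  proof -
    have "x * (\<beta> * m + \<alpha> * \<gamma>) * (\<sigma> x * (\<beta> * m + \<omega> * \<alpha> * \<gamma>))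
      = y * (\<beta> * k + \<alpha> * \<gamma>) * (\<sigma> y * (\<beta> * k + \<omega> * \<alpha> * \<gamma>))"
      using eq1 eq2 by simp
    thus ?thesis by (simp add: m_def k_def mult_ac)
  qed
  define A where "A = (\<lambda>u v. \<beta> * (u + \<omega> * v) + \<gamma> * \<omega> * \<alpha>)"
  \<comment> \<open>The relation \<open>\<omega>\<^sup>2 + 1 = \<omega>\<close> is what splits
    \<open>\<omega> * (m\<^sup>2 + m * k + k\<^sup>2)\<close> as
    \<open>(m + \<omega> * k) * (k + \<omega> * m)\<close>; the last summand is the correction that
    it kills.\<close>
  have "(m - k) * A m k * A k m
      = \<omega> * (m * (\<beta> * m + \<alpha> * \<gamma>) * (\<beta> * m + \<omega> * \<alpha> * \<gamma>)
           - k * (\<beta> * k + \<alpha> * \<gamma>) * (\<beta> * k + \<omega> * \<alpha> * \<gamma>))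
        + (m - k) * \<beta>\<^sup>2 * m * k * (\<omega>\<^sup>2 - \<omega> + 1)"
    unfolding A_def by algebra
  hence prod0: "(m - k) * A m k * A k m = 0"
    using norms \<omega> by simp
  have conj: "A v u = 0" if "A u v = 0" "\<sigma> u = u" "\<sigma> v = v" for u v
  proof -
    have "\<beta> * (u + \<sigma> \<omega> * v) + \<gamma> * (\<sigma> \<omega> * (\<omega> * \<alpha>)) = 0"
      using arg_cong[OF that(1), of \<sigma>] that(2,3) \<alpha>(2)
      by (simp add: A_def mult add fixed \<sigma>0 mult_ac)
    \<comment> \<open>The bracket is \<open>\<sigma> (A u v)\<close>, so swapping the arguments of
      \<open>A\<close> is conjugation up to the unit \<open>\<omega>\<close>.\<close>
    moreover have "A v u = \<omega> * (\<beta> * (u + \<sigma> \<omega> * v) + \<gamma> * (\<sigma> \<omega> * (\<omega> * \<alpha>)))"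
      unfolding A_def using \<sigma>\<omega> by algebra
    ultimately show ?thesis by simp
  qed
  have "m = k" if "\<beta> \<noteq> 0"
  proof (rule ccontr)
    assume "m \<noteq> k"
    hence "A m k = 0" "A k m = 0"
      using prod0 conj[of m k] conj[of k m] \<sigma>m \<sigma>k by auto
    hence "\<beta> * (1 - \<omega>) * (m - k) = 0"
      unfolding A_def by algebra
    with that \<omega> \<open>m \<noteq> k\<close> show False by simp
  qed
  hence \<beta>mk: "\<beta> * m = \<beta> * k" by auto
  show "x = y"
  proof (cases "\<beta> * m + \<alpha> * \<gamma> = 0")
    case False
    thus ?thesis using eq1 \<beta>mk by simp
  next
    \<comment> \<open>The factor cannot be cancelled here. Comparing it with its conjugate gives
      \<open>\<gamma> = 0\<close>, so \<open>\<beta>\<close> is nonzero and both norms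
      vanish.\<close>
    case True
    from arg_cong[OF True, of \<sigma>] have "\<beta> * m + \<omega> * \<alpha> * \<gamma> = 0"
      by (simp add: mult add \<sigma>m fixed \<alpha> \<sigma>0)
    with True have "(1 - \<omega>) * (\<alpha> * \<gamma>) = 0" by algebra
    hence "\<gamma> = 0" using \<omega> \<alpha> by simp
    with True nz \<beta>mk have "m = 0" "k = 0" by auto
    have zero: "z = 0" if "z * \<sigma> z = 0" for z
      using that invol[of z] \<sigma>0 by auto
    have "x = 0" "y = 0"
      using zero[of x] zero[of y] \<open>m = 0\<close> \<open>k = 0\<close> by (simp_all only: m_def k_def)
    thus ?thesis by simp
  qed
qed

text \<open>Multiplication by a nonzero \<open>x\<close> permutes the nonzero elements of
  \<open>K\<close>, so it leaves their product unchanged.\<close>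

lemma subfield_power_card_eq_same:
  fixes K :: "'a::finite_field set"
  assumes K: "is_subfield K" and x: "x \<in> K"
  shows "x ^ card K = x"
proof (cases "x = 0")
  case True
  have "card K > 0" using x by (auto simp: card_gt_0_iff)
  with True show ?thesis by simp
next
  case False
  have "(\<Prod>y\<in>K-{0}. x * y) = (\<Prod>y\<in>K-{0}. y)"
    by (rule prod.reindex_bij_witness[of _ "\<lambda>y. inverse x * y" "\<lambda>y. x * y"])
       (use False x K in \<open>auto simp: is_subfield_def\<close>)
  moreover have "(\<Prod>y\<in>K-{0}. x * y) = x ^ card (K - {0}) * \<Prod>(K-{0})"
    by (simp add: prod.distrib)
  ultimately have "x ^ card (K - {0}) = 1" by simp
  moreover have "card K = Suc (card (K - {0}))"
    using K by (intro card.remove) (auto simp: is_subfield_def)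
  ultimately show ?thesis by simp
qed

text \<open>The sum of all field elements is invariant under the shift by 1, so the cardinality is
  zero in the field and the prime characteristic divides it.\<close>

lemma CHAR_of_prime_power_card:
  fixes p n :: nat
  assumes "prime p" and "CARD('a::finite_field) = p ^ n"
  shows "CHAR('a) = p"
proof -
  have "prime CHAR('a)"
    by (rule prime_CHAR_semidom) (simp add: finite_imp_CHAR_pos)
  moreover have "CHAR('a) dvd p ^ n"
  proof -
    have "(\<Sum>x\<in>UNIV. x + 1) = (\<Sum>x\<in>UNIV. x :: 'a)"
      by (rule sum.reindex_bij_witness[of _ "\<lambda>x. x - 1" "\<lambda>x. x + 1"]) auto
    hence "of_nat CARD('a) = (0 :: 'a)"
      by (simp add: sum.distrib)
    thus ?thesis
      using assms(2) of_nat_eq_0_iff_char_dvd by metis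
  qed
  ultimately show ?thesis
    using assms(1) by (metis prime_dvd_power primes_dvd_imp_eq)
qed

text \<open>In the factorization of \<open>x ^ 6 - 1\<close> only the sixth cyclotomic factor can
  vanish at an element of order 6.\<close>

lemma order_6_root:
  fixes x :: "'a::field"
  assumes "has_mult_order x 6"
  shows "x\<^sup>2 - x + 1 = 0" and "x \<noteq> 1"
proof -
  have 6: "x ^ 6 = 1" and 3: "x ^ 3 \<noteq> 1" and 2: "x ^ 2 \<noteq> 1"
    using assms by (auto simp: has_mult_order_def)
  have "(x ^ 3 - 1) * ((x + 1) * (x\<^sup>2 - x + 1)) = x ^ 6 - 1" by algebra
  moreover have "x + 1 \<noteq> 0"
    using 2 by (metis add_eq_0_iff2 power_one power2_minus)
  ultimately show "x\<^sup>2 - x + 1 = 0" using 6 3 by simp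
  show "x \<noteq> 1" using 3 by auto
qed

lemma order_3_root:
  fixes x :: "'a::field"
  assumes "has_mult_order x 3"
  shows "x\<^sup>2 + x + 1 = 0" and "x \<noteq> 1"
proof -
  have 3: "x ^ 3 = 1" and 1: "x ^ 1 \<noteq> 1"
    using assms unfolding has_mult_order_def by force+
  show "x \<noteq> 1" using 1 by simp
  have "(x - 1) * (x\<^sup>2 + x + 1) = x ^ 3 - 1" by algebra
  with 3 \<open>x \<noteq> 1\<close> show "x\<^sup>2 + x + 1 = 0" by simp
qed

lemma order_2_root:
  fixes x :: "'a::field"
  assumes "has_mult_order x 2"
  shows "x = - 1" and "x \<noteq> 1"
proof -
  have 2: "x ^ 2 = 1" and 1: "x ^ 1 \<noteq> 1"
    using assms unfolding has_mult_order_def by force+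
  show "x \<noteq> 1" using 1 by simp
  with 2 show "x = - 1" by (simp add: power2_eq_1_iff)
qed

lemma latin_square_poly_square:
  fixes f :: "'a::finite_field poly"
  assumes "bij (poly f)"
  shows "latin_square UNIV (poly_square f)"
  unfolding latin_square_def
proof (intro conjI allI ballI)
  fix i s :: 'a
  have "\<exists>!j. poly f j = s - i"
    using assms by (metis bij_pointE)
  thus "\<exists>!j. poly_square f $ i $ j = s"
    by (simp add: poly_square_def eq_diff_eq add.commute)
next
  fix j s :: 'a
  show "\<exists>!i. poly_square f $ i $ j = s"
    by (rule ex1I[of _ "s - poly f j"]) (auto simp: poly_square_def)
qed auto

text \<open>Eliminating the row from the two entry equations leaves
  \<open>poly (f - g) j = s - t\<close> for the column.\<close>

lemma orthogonal_poly_square: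
  fixes f g :: "'a::finite_field poly"
  assumes "surj (poly (f - g))"
  shows "orthogonal_squares UNIV (poly_square f) (poly_square g)"
  unfolding orthogonal_squares_def
proof (intro ballI)
  fix s t :: 'a
  obtain j where "s - t = poly (f - g) j"
    using assms by (rule surjE)
  hence "t - poly g j + poly f j = s" by (simp add: algebra_simps)
  thus "\<exists>i j. poly_square f $ i $ j = s \<and> poly_square g $ i $ j = t"
    by (intro exI[of _ "t - poly g j"] exI[of _ j]) (simp add: poly_square_def)
qed

lemma poly_square_eqD: "poly_square f = poly_square g \<Longrightarrow> poly f = poly g"
  by (auto simp: poly_square_def vec_eq_iff)

text \<open>Closure under differences turns orthogonality of two squares into surjectivity of a
  single member of \<open>F\<close>. Only distinct members are subtracted, since the zero polynomial
  is not bijective.\<close>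

lemma MOLS_poly_square:
  fixes F :: "'a::finite_field poly set"
  assumes bij: "\<And>f. f \<in> F \<Longrightarrow> bij (poly f)"
    and diff: "\<And>f g. f \<in> F \<Longrightarrow> g \<in> F \<Longrightarrow> f \<noteq> g \<Longrightarrow> f - g \<in> F"
  shows "is_MOLS UNIV (poly_square ` F)" and "inj_on poly_square F"
proof -
  show "inj_on poly_square F"
  proof (rule inj_onI, rule ccontr)
    fix f g assume fg: "f \<in> F" "g \<in> F" "poly_square f = poly_square g" "f \<noteq> g"
    from poly_square_eqD[OF fg(3)] have "poly (f - g) 0 = poly (f - g) 1" by simp
    with bij[OF diff[OF fg(1,2,4)]] show False by (metis bij_pointE zero_neq_one)
  qed
  show "is_MOLS UNIV (poly_square ` F)"
    unfolding is_MOLS_def pairwise_def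
    using bij diff by (auto intro!: latin_square_poly_square orthogonal_poly_square bij_is_surj)
qed

theorem corollary4p1:
  fixes Q :: nat and K :: "'a::finite_field set" and \<alpha> :: 'a and F :: "'a poly set"
  assumes "primepow Q" and "\<not> [Q = 1] (mod 3)"
    and "CARD('a) = Q ^ 2" and "is_subfield K" and "card K = Q"
    and "[Q = 5] (mod 6) \<Longrightarrow> has_mult_order (\<alpha> ^ (Q - 1)) 6"
    and "[Q = 0] (mod 2) \<Longrightarrow> has_mult_order (\<alpha> ^ (Q - 1)) 3"
    and "[Q = 0] (mod 3) \<Longrightarrow> has_mult_order (\<alpha> ^ (Q - 1)) 2"
    and "F = {monom \<beta> (Q + 2) + monom (\<alpha> * \<gamma>) 1 | \<beta> \<gamma>.
                \<beta> \<in> K \<and> \<gamma> \<in> K \<and> (\<beta> \<noteq> 0 \<or> \<gamma> \<noteq> 0)}"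
  shows "(\<forall>f\<in>F. bij (poly f)) \<and>
         complete_MOLS UNIV (poly_square ` F) \<and>
         card (poly_square ` F) = Q ^ 2 - 1"
proof -
  define \<omega> where "\<omega> = \<alpha> ^ (Q - 1)"
  obtain p n where p: "prime p" "n > 0" "Q = p ^ n"
    using assms(1) by (auto simp: primepow_def)
  have Q: "Q > 1" using primepow_gt_Suc_0[OF assms(1)] by simp
  have "CARD('a) = p ^ (n * 2)"
    using assms(3) p by (simp add: power_mult)
  hence char: "CHAR('a) = p" by (rule CHAR_of_prime_power_card[OF p(1)])
  have char_zero: "of_nat q = (0 :: 'a)" if "prime q" "q dvd Q" for q
    using that p char by (metis of_nat_CHAR prime_dvd_power primes_dvd_imp_eq)
  have \<omega>: "\<omega>\<^sup>2 - \<omega> + 1 = 0 \<and> \<omega> \<noteq> 1"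
  proof -
    have "Q mod 3 \<noteq> 1" using assms(2) by (simp add: cong_def)
    hence "Q mod 3 = 0 \<or> Q mod 2 = 0 \<or> Q mod 6 = 5" by presburger
    then consider "Q mod 3 = 0" | "Q mod 2 = 0" | "Q mod 6 = 5" by metis
    thus ?thesis
    proof cases
      case 1
      hence "has_mult_order \<omega> 2" using assms(8) by (simp add: \<omega>_def cong_def)
      note r = order_2_root[OF this]
      \<comment> \<open>With \<open>\<omega> = - 1\<close> the quadratic takes the value 3.\<close>
      have "of_nat 3 = (0 :: 'a)" using 1 by (intro char_zero) auto
      with r show ?thesis by simp
    next
      case 2
      hence "has_mult_order \<omega> 3" using assms(7) by (simp add: \<omega>_def cong_def)
      note r = order_3_root[OF this]
      \<comment> \<open>In characteristic 2 the third and sixth cyclotomic polynomials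
        coincide.\<close>
      have "of_nat 2 = (0 :: 'a)" using 2 by (intro char_zero) auto
      hence "2 * \<omega> = 0" by simp
      moreover have "\<omega>\<^sup>2 - \<omega> + 1 = (\<omega>\<^sup>2 + \<omega> + 1) - 2 * \<omega>" by simp
      ultimately show ?thesis using r by (simp only: diff_zero) simp
    next
      case 3
      hence "has_mult_order \<omega> 6" using assms(6) by (simp add: \<omega>_def cong_def)
      from order_6_root[OF this] show ?thesis by blast
    qed
  qed
  have \<alpha>0: "\<alpha> \<noteq> 0"
  proof
    assume "\<alpha> = 0"
    hence "\<omega> = 0" using Q by (simp add: \<omega>_def)
    with \<omega> show False by simp
  qed
  have \<alpha>\<omega>: "\<alpha> ^ Q = \<omega> * \<alpha>"
    using Q by (simp add: \<omega>_def flip: power_Suc2)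
  \<comment> \<open>\<open>Q\<close> is a power of the characteristic, so x -> x^Q is
    additive.\<close>
  have frob_add: "(x + y) ^ Q = x ^ Q + y ^ Q" for x y :: 'a
    using p char by (intro freshmans_dream') auto
  have frob_invol: "(x ^ Q) ^ Q = x" for x :: 'a
    using finite_field_power_card_eq_same[of x] assms(3)
    by (simp add: power2_eq_square power_mult)
  have frob_K: "x ^ Q = x" if "x \<in> K" for x
    using subfield_power_card_eq_same[OF assms(4) that] assms(5) by simp
  \<comment> \<open>\<open>P\<close> is additive in the pair of parameters, and injective because
    the exponents \<open>Q + 2\<close> and 1 differ and \<open>\<alpha>\<close> is nonzero. Hence
    \<open>F\<close> is closed under differences of distinct members and has as many elements as
    there are nonzero pairs.\<close>
  define P where "P = (\<lambda>(\<beta>, \<gamma>). monom \<beta> (Q + 2) + monom (\<alpha> * \<gamma>) 1)"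
  have F: "F = P ` (K \<times> K - {(0, 0)})"
    unfolding assms(9) P_def by auto
  have bij: "bij (poly f)" if f: "f \<in> F" for f
  proof -
    from f obtain \<beta> \<gamma> where f: "f = P (\<beta>, \<gamma>)" and \<beta>\<gamma>: "\<beta> \<in> K" "\<gamma> \<in> K" "\<beta> \<noteq> 0 \<or> \<gamma> \<noteq> 0"
      unfolding F by auto
    have "poly f = (\<lambda>x. \<beta> * (x\<^sup>2 * x ^ Q) + \<alpha> * \<gamma> * x)"
      by (auto simp: f P_def poly_monom power_add mult_ac power2_eq_square)
    moreover have "inj (\<lambda>x. \<beta> * (x\<^sup>2 * x ^ Q) + \<alpha> * \<gamma> * x)"
      by (rule involution_cubic_inj[where \<omega> = \<omega>])
         (use frob_add frob_invol \<alpha>0 \<alpha>\<omega> \<omega> frob_K \<beta>\<gamma> in \<open>auto simp: power_mult_distrib\<close>)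
    ultimately show ?thesis by (simp add: bij_def finite_UNIV_inj_surj)
  qed
  have K_diff: "x - y \<in> K" if "x \<in> K" "y \<in> K" for x y
    using assms(4) that unfolding is_subfield_def by (auto simp flip: add_uminus_conv_diff)
  have P_diff: "P u - P v = P (u - v)" for u v
    by (cases u; cases v) (simp add: P_def right_diff_distrib flip: diff_monom)
  have diff: "f - g \<in> F" if fg: "f \<in> F" "g \<in> F" "f \<noteq> g" for f g
  proof -
    from fg obtain u v where "f = P u" "g = P v" "u \<in> K \<times> K" "v \<in> K \<times> K"
      unfolding F by blast
    thus ?thesis
      using fg(3) unfolding F
      by (auto simp: P_diff K_diff intro!: imageI)
  qed
  have inj_P: "inj P"
  proof (rule injI)
    fix u v assume uv: "P u = P v"
    have "coeff (P u) (Q + 2) = coeff (P v) (Q + 2)" "coeff (P u) 1 = coeff (P v) 1"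
      using uv by simp_all
    thus "u = v"
      using \<alpha>0 by (cases u; cases v) (simp add: P_def)
  qed
  have K0: "0 \<in> K" using assms(4) by (simp add: is_subfield_def)
  have "card F = card (K \<times> K - {(0, 0)})"
    unfolding F by (rule card_image) (use inj_P inj_on_subset in blast)
  also have "\<dots> = Q\<^sup>2 - 1"
    using K0 assms(5) by (simp add: power2_eq_square card_cartesian_product)
  finally have "card F = Q\<^sup>2 - 1" .
  moreover have mols: "is_MOLS UNIV (poly_square ` F)" "inj_on poly_square F"
    using MOLS_poly_square[of F] bij diff by blast+
  ultimately have "card (poly_square ` F) = Q\<^sup>2 - 1"
    by (simp add: card_image)
  moreover have "finite F" unfolding F by simp
  ultimately show ?thesis
    using bij mols assms(3) by (simp add: complete_MOLS_def)
qed

end
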